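(* In dimension $1$, let $a(t,x)=1$ for all $(t,x)$ and $\rho^{ini}=\delta_0$, so that the solution of $\partial_t\rho+\partial_x(a\rho)=0$ with initial datum $\rho^{ini}$ is $\rho(t)=\delta_t$. Let $\Delta t,\Delta x>0$ satisfy $\Delta t/\Delta x=1/2$, and let $(\rho^n_j)_{n\in\mathbb{N},j\in\mathbb{Z}}$ be given by the upwind scheme, which here reads $$\rho^0_j=\delta_{0j},\qquad \rho^{n+1}_j=\rho^n_j-\tfrac12(\rho^n_j-\rho^n_{j-1}).$$ With $t^n=n\Delta t$ and $\rho^n_{\Delta x}=\sum_{j\in\mathbb{Z}}\rho^n_j\delta_{j\Delta x}$, one has $$W_1\bigl(\rho(t^n),\rho^n_{\Delta x}\bigr)\sim_{n\to\infty}\frac1{\sqrt\pi}\sqrt{t^n\Delta x}.$$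
   Context: $W_1$ is the Wasserstein distance of order $1$ on probability measures on $\mathbb{R}$ with finite first moment; $\delta_y$ is the Dirac mass at $y$ and $\delta_{0j}$ the Kronecker symbol. $u_n\sim_{n\to\infty}v_n$ means $u_n/v_n\to1$. *)

theory Defs
  imports "HOL-Probability.Probability" "HOL-Library.Landau_Symbols"
begin

definition couplings :: "real measure \<Rightarrow> real measure \<Rightarrow> (real \<times> real) measure set" where
  "couplings \<mu> \<nu> =
     {\<gamma>. sets \<gamma> = sets (borel \<Otimes>\<^sub>M borel) \<and> distr \<gamma> borel fst = \<mu> \<and> distr \<gamma> borel snd = \<nu>}"

text \<open>The infimum is finite as soon as both arguments are probability measures on the Borel
  sets with finite first moment; only then is the value meant to be used.\<close>
definition wasserstein1 :: "real measure \<Rightarrow> real measure \<Rightarrow> real" where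
  "wasserstein1 \<mu> \<nu> =
     enn2real (INF \<gamma>\<in>couplings \<mu> \<nu>. \<integral>\<^sup>+ p. ennreal \<bar>fst p - snd p\<bar> \<partial>\<gamma>)"

text \<open>The measure \<open>\<Sum>j. r j \<delta>(j dx)\<close> for nonnegative weights \<open>r\<close>.\<close>
definition grid_measure :: "real \<Rightarrow> (int \<Rightarrow> real) \<Rightarrow> real measure" where
  "grid_measure dx r =
     distr (point_measure UNIV (\<lambda>j. ennreal (r j))) borel (\<lambda>j. real_of_int j * dx)"

text \<open>\<open>\<phi>\<close> is continuously differentiable with compact support in \<open>(0, \<infinity>) \<times> \<real>\<close>, and
  \<open>\<phi>\<^sub>t\<close>, \<open>\<phi>\<^sub>x\<close> are its partial derivatives. Since the equation below involves only measures
  and first-order derivatives of \<open>\<phi>\<close>, testing against these functions is the same as testing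
  against smooth compactly supported ones.\<close>
definition test_function ::
  "(real \<times> real \<Rightarrow> real) \<Rightarrow> (real \<times> real \<Rightarrow> real) \<Rightarrow> (real \<times> real \<Rightarrow> real) \<Rightarrow> bool" where
  "test_function \<phi> \<phi>\<^sub>t \<phi>\<^sub>x \<longleftrightarrow>
     (\<forall>p. (\<phi> has_derivative (\<lambda>h. \<phi>\<^sub>t p * fst h + \<phi>\<^sub>x p * snd h)) (at p)) \<and>
     continuous_on UNIV \<phi>\<^sub>t \<and> continuous_on UNIV \<phi>\<^sub>x \<and>
     (\<exists>K. compact K \<and> K \<subseteq> {0<..} \<times> UNIV \<and> (\<forall>p. p \<notin> K \<longrightarrow> \<phi> p = 0))"

text \<open>\<open>\<rho>\<close> is a narrowly continuous curve of probability measures on the line, indexed by times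
  \<open>t \<ge> 0\<close>, that solves \<open>\<partial>\<^sub>t \<rho> + \<partial>\<^sub>x (a \<rho>) = 0\<close> in the sense of distributions with
  \<open>\<rho> 0 = \<rho>ini\<close>. The velocity \<open>a\<close> is meant to be a bounded Borel function, so that the
  integrals exist.\<close>
definition transport_solution ::
  "(real \<Rightarrow> real \<Rightarrow> real) \<Rightarrow> real measure \<Rightarrow> (real \<Rightarrow> real measure) \<Rightarrow> bool" where
  "transport_solution a \<rho>ini \<rho> \<longleftrightarrow>
     (\<forall>t\<ge>0. real_distribution (\<rho> t)) \<and>
     (\<forall>f. continuous_on UNIV f \<and> bounded (range f) \<longrightarrow>
        continuous_on {0..} (\<lambda>t. LINT x|\<rho> t. (f x :: real))) \<and>
     \<rho> 0 = \<rho>ini \<and>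
     (\<forall>\<phi> \<phi>\<^sub>t \<phi>\<^sub>x. test_function \<phi> \<phi>\<^sub>t \<phi>\<^sub>x \<longrightarrow>
        (LINT t:{0<..}|lborel. (LINT x|\<rho> t. \<phi>\<^sub>t (t, x) + a t x * \<phi>\<^sub>x (t, x))) = 0)"

end

theory Submission
  imports Defs "HOL-Real_Asymp.Real_Asymp"
begin

text \<open>Uniqueness: testing the equation with \<open>\<eta>(t) \<psi>(x - t)\<close> shows that
  \<open>g(t) = \<integral> \<psi>(x - t) d\<sigma>\<^sub>t(x)\<close> has vanishing weak derivative, so \<open>g(t) = g(0) = \<psi>(0)\<close>; if \<open>\<psi>\<close> attains
  its maximum only at \<open>0\<close>, this forces \<open>\<sigma>\<^sub>t = \<delta>\<^sub>t\<close>.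

  Asymptotics: \<open>r n\<close> is the binomial law with parameters \<open>n\<close> and \<open>1/2\<close>, and the only coupling with a
  Dirac mass is the product, so the distance is \<open>dx\<close> times the mean absolute deviation of that law.
  With \<open>m = n div 2\<close> this deviation is \<open>(n / 2) (2m choose m) / 4 ^ m\<close> (de Moivre), and Wallis'
  product gives its growth.\<close>

section \<open>Existence: the moving Dirac mass solves the transport equation\<close>

text \<open>The complement of \<open>K\<close> is open and \<open>\<phi>\<close> is zero on it, so
  uniqueness of the derivative makes both partial derivatives vanish there as well. Boundedness of
  \<open>K\<close> then gives the time horizon \<open>T\<close>.\<close>

lemma test_function_eq_0:
  assumes "test_function \<phi> \<phi>t \<phi>x"
  obtains T where "T > 0" and "\<And>t x. t \<le> 0 \<or> T \<le> t \<Longrightarrow> \<phi> (t, x) = 0 \<and> \<phi>t (t, x) = 0 \<and> \<phi>x (t, x) = 0"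
proof -
  obtain K where "compact K" and K: "K \<subseteq> {0<..} \<times> UNIV" "\<And>p. p \<notin> K \<Longrightarrow> \<phi> p = 0"
    and der: "\<And>p. (\<phi> has_derivative (\<lambda>h. \<phi>t p * fst h + \<phi>x p * snd h)) (at p)"
    using assms unfolding test_function_def by metis
  have zero: "\<phi> p = 0 \<and> \<phi>t p = 0 \<and> \<phi>x p = 0" if "p \<notin> K" for p
  proof -
    have "open (- K)" using \<open>compact K\<close> by (simp add: compact_imp_closed open_Compl)
    then have "(\<phi> has_derivative (\<lambda>h. 0)) (at p)"
      using that K(2) by (intro has_derivative_transform_within_open[OF has_derivative_const[of 0]]) auto
    then have "(\<lambda>h. \<phi>t p * fst h + \<phi>x p * snd h) = (\<lambda>h. 0)"
      by (rule has_derivative_unique[OF der])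
    from fun_cong[OF this, of "(1, 0)"] fun_cong[OF this, of "(0, 1)"] K(2)[OF that]
    show ?thesis by simp
  qed
  have "bounded K" using \<open>compact K\<close> by (rule compact_imp_bounded)
  then have "bounded (fst ` K)" by (rule bounded_fst)
  then obtain B where B: "\<And>t. t \<in> fst ` K \<Longrightarrow> \<bar>t\<bar> \<le> B"
    unfolding bounded_real by blast
  show ?thesis
  proof
    \<comment> \<open>Adding 1 keeps the horizon strictly beyond every time in \<open>K\<close>, and
      the absolute value keeps it positive even if \<open>K\<close> is empty and \<open>B\<close>
      negative.\<close>
    show "\<bar>B\<bar> + 1 > 0" by simp
    show "\<phi> (t, x) = 0 \<and> \<phi>t (t, x) = 0 \<and> \<phi>x (t, x) = 0" if "t \<le> 0 \<or> \<bar>B\<bar> + 1 \<le> t" for t x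
    proof (rule zero)
      show "(t, x) \<notin> K"
        using K(1) B[of t] that by force
    qed
  qed
qed

text \<open>Integrating against the Dirac mass evaluates the integrand on the characteristic
  \<open>x = t\<close>, where it is the derivative of \<open>\<phi> (t, t)\<close>. The time
  integral is thus a difference of boundary values, both zero.\<close>

lemma transport_solution_moving_dirac:
  assumes "\<And>t. t \<ge> 0 \<Longrightarrow> \<sigma> t = return borel t"
  shows "transport_solution (\<lambda>_ _. 1) (return borel 0) \<sigma>"
  unfolding transport_solution_def
proof (intro conjI allI impI)
  show "real_distribution (\<sigma> t)" if "t \<ge> 0" for t
    unfolding assms[OF that] real_distribution_def real_distribution_axioms_def
    by (simp add: prob_space_return)
  show "continuous_on {0..} (\<lambda>t. LINT x|\<sigma> t. f x)"
    if "continuous_on UNIV f \<and> bounded (range f)" for f :: "real \<Rightarrow> real"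
  proof -
    have "(LINT x|\<sigma> t. f x) = f t" if "t \<in> {0..}" for t
      using that \<open>continuous_on UNIV f \<and> bounded (range f)\<close>
      by (simp add: assms integral_return borel_measurable_continuous_onI)
    moreover have "continuous_on {0..} f"
      using that by (blast intro: continuous_on_subset)
    ultimately show ?thesis by (simp only: cong: continuous_on_cong)
  qed
  show "\<sigma> 0 = return borel 0" by (simp add: assms)
  fix \<phi> \<phi>t \<phi>x :: "real \<times> real \<Rightarrow> real"
  assume test: "test_function \<phi> \<phi>t \<phi>x"
  then have der: "\<And>p. (\<phi> has_derivative (\<lambda>h. \<phi>t p * fst h + \<phi>x p * snd h)) (at p)"
    and cont: "continuous_on UNIV \<phi>t" "continuous_on UNIV \<phi>x"
    by (auto simp: test_function_def)
  obtain T where T: "T > 0" "\<And>t x. t \<le> 0 \<or> T \<le> t \<Longrightarrow> \<phi> (t, x) = 0 \<and> \<phi>t (t, x) = 0 \<and> \<phi>x (t, x) = 0"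
    using test_function_eq_0[OF test] by blast
  let ?f = "\<lambda>t. \<phi>t (t, t) + \<phi>x (t, t)"
  have [measurable]: "\<phi>t \<in> borel_measurable borel" "\<phi>x \<in> borel_measurable borel"
    using cont by (auto intro: borel_measurable_continuous_onI)
  \<comment> \<open>The partial derivatives vanish at time 0 and from \<open>T\<close> on, so the
    half-line may be traded for the compact interval that the fundamental theorem of calculus
    needs.\<close>
  have "indicator {0<..} t *\<^sub>R (LINT x|\<sigma> t. \<phi>t (t, x) + 1 * \<phi>x (t, x)) = ?f t * indicator {0..T} t" for t
  proof (cases "0 < t")
    case True
    then show ?thesis using T(2)[of t t]
      by (auto simp: assms integral_return indicator_def)
  next
    case False
    then show ?thesis using T(2)[of t t] by simp
  qed
  moreover have "(LINT t|lborel. ?f t * indicator {0..T} t) = \<phi> (T, T) - \<phi> (0, 0)"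
  proof (rule integral_FTC_Icc_real)
    show "((\<lambda>t. \<phi> (t, t)) has_real_derivative ?f t) (at t)" for t
      unfolding has_field_derivative_def
      by (rule has_derivative_eq_rhs[OF has_derivative_compose[OF
            has_derivative_Pair[OF has_derivative_ident has_derivative_ident] der]])
         (simp add: fun_eq_iff algebra_simps)
    have "continuous_on UNIV ?f"
      by (intro continuous_on_add continuous_on_compose2[OF cont(1)] continuous_on_compose2[OF cont(2)]
          continuous_intros) auto
    then show "isCont ?f t" for t
      by (simp add: continuous_on_eq_continuous_at)
  qed (use T in auto)
  ultimately show "(LINT t:{0<..}|lborel. LINT x|\<sigma> t. \<phi>t (t, x) + 1 * \<phi>x (t, x)) = 0"
    using T by (simp add: set_lebesgue_integral_def)
qed

section \<open>Uniqueness of the solution\<close>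

text \<open>The antiderivative \<open>\<eta>\<close> of \<open>k (g - c)\<close>, for a bump \<open>k\<close> on \<open>[\<alpha>, \<beta>]\<close> and the \<open>k\<close>-weighted
  mean \<open>c\<close> of \<open>g\<close>, has compact support, and testing with it gives \<open>\<integral> k (g - c)\<^sup>2 = 0\<close>.\<close>
lemma weak_derivative_zero_imp_constant:
  fixes g :: "real \<Rightarrow> real"
  assumes cont: "continuous_on {0..} g"
    and orth: "\<And>\<eta> \<eta>' \<alpha> \<beta>. 0 < \<alpha> \<Longrightarrow> \<alpha> < \<beta> \<Longrightarrow>
      (\<And>t. (\<eta> has_real_derivative \<eta>' t) (at t)) \<Longrightarrow> continuous_on UNIV \<eta>' \<Longrightarrow>
      (\<And>t. t \<notin> {\<alpha>..\<beta>} \<Longrightarrow> \<eta> t = 0 \<and> \<eta>' t = 0) \<Longrightarrow>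
      integral {\<alpha>..\<beta>} (\<lambda>t. \<eta>' t * g t) = 0"
    and "t \<ge> 0"
  shows "g t = g 0"
proof -
  have loc: "\<exists>c. \<forall>t\<in>{\<alpha><..<\<beta>}. g t = c" if "0 < \<alpha>" "\<alpha> < \<beta>" for \<alpha> \<beta>
  proof -
    \<comment> \<open>The positive part of a parabola with roots \<open>\<alpha>\<close> and
      \<open>\<beta>\<close>: continuity and positivity exactly on the open interval suffice, since
      only the antiderivative must be differentiable.\<close>
    define k where "k t = max 0 ((t - \<alpha>) * (\<beta> - t))" for t
    have k_cont: "continuous_on S k" for S
      unfolding k_def by (intro continuous_intros)
    have k_out: "k t = 0" if "t \<notin> {\<alpha><..<\<beta>}" for t
      using that \<open>\<alpha> < \<beta>\<close> by (auto simp: k_def max_def zero_le_mult_iff not_less)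
    have k_pos: "k t > 0" if "t \<in> {\<alpha><..<\<beta>}" for t
      using that by (auto simp: k_def less_max_iff_disj)
    have k_nonneg: "k t \<ge> 0" for t by (simp add: k_def)
    have g_cont: "continuous_on {\<alpha>..\<beta>} g"
      using cont by (rule continuous_on_subset) (use \<open>0 < \<alpha>\<close> in auto)
    have "integral {\<alpha>..\<beta>} k \<noteq> 0"
      using integral_eq_0_iff[OF k_cont \<open>\<alpha> < \<beta>\<close> k_nonneg] k_pos[of "(\<alpha> + \<beta>) / 2"] \<open>\<alpha> < \<beta>\<close>
      by (auto intro!: bexI[of _ "(\<alpha> + \<beta>) / 2"])
    define c where "c = integral {\<alpha>..\<beta>} (\<lambda>t. k t * g t) / integral {\<alpha>..\<beta>} k"
    \<comment> \<open>\<open>g\<close> is continuous only on the half-line; the argument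
      \<open>max 0 t\<close> makes \<open>h\<close> continuous everywhere, without changing it on
      the support of \<open>k\<close>.\<close>
    define h where "h t = k t * (g (max 0 t) - c)" for t
    have h_cont: "continuous_on S h" for S
      unfolding h_def
      by (intro continuous_intros k_cont continuous_on_compose2[OF cont]) auto
    have h_eq: "h t = k t * (g t - c)" if "t \<in> {\<alpha>..\<beta>}" for t
      using that \<open>0 < \<alpha>\<close> by (simp add: h_def)
    have int: "(\<lambda>t. k t * g t) integrable_on {\<alpha>..\<beta>}" "(\<lambda>t. k t * c) integrable_on {\<alpha>..\<beta>}"
      "(\<lambda>t. h t * g t) integrable_on {\<alpha>..\<beta>}" "(\<lambda>t. h t * c) integrable_on {\<alpha>..\<beta>}"
      by (intro integrable_continuous_interval continuous_intros k_cont g_cont h_cont)+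
    have "integral {\<alpha>..\<beta>} h = integral {\<alpha>..\<beta>} (\<lambda>t. k t * g t - k t * c)"
      by (rule integral_cong) (simp add: h_eq algebra_simps)
    also have "\<dots> = 0"
      using int \<open>integral {\<alpha>..\<beta>} k \<noteq> 0\<close> by (simp add: integral_diff c_def)
    finally have h_int: "integral {\<alpha>..\<beta>} h = 0" .
    obtain F where F: "\<And>t. (F has_real_derivative h t) (at t)"
    proof -
      have "\<exists>F. \<forall>x::real. -\<infinity> < ereal x \<longrightarrow> ereal x < \<infinity> \<longrightarrow> (F has_vector_derivative h x) (at x)"
        using h_cont[of UNIV] by (intro einterval_antiderivative) (auto simp: continuous_on_eq_continuous_at)
      then show ?thesis using that by (auto simp: has_real_derivative_iff_has_vector_derivative)
    qed
    have FTC: "integral {s..t} h = F t - F s" if "s \<le> t" for s t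
    proof (intro integral_unique fundamental_theorem_of_calculus that)
      show "(F has_vector_derivative h x) (at x within {s..t})" for x
        using has_field_derivative_at_within[OF F]
        by (simp add: has_real_derivative_iff_has_vector_derivative)
    qed
    have zero: "integral {s..t} h = 0" if "t \<le> \<alpha> \<or> \<beta> \<le> s" for s t
    proof -
      have "integral {s..t} h = integral {s..t} (\<lambda>_. 0)"
        by (rule integral_cong) (use that in \<open>auto simp: h_def k_out\<close>)
      then show ?thesis by simp
    qed
    \<comment> \<open>\<open>F\<close> is constant on each side of the interval, and the two
      constants agree because the choice of \<open>c\<close> gives \<open>h\<close> integral zero.
      Hence \<open>F t - F \<alpha>\<close> is an admissible \<open>\<eta>\<close>.\<close>
    have "F t = F \<alpha>" if "t \<notin> {\<alpha>..\<beta>}" for t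
      using that FTC[of t \<alpha>] FTC[of \<beta> t] FTC[of \<alpha> \<beta>] zero[of \<alpha> t] zero[of t \<beta>] h_int \<open>\<alpha> < \<beta>\<close>
      by (cases "t < \<alpha>") auto
    then have "integral {\<alpha>..\<beta>} (\<lambda>t. h t * g t) = 0"
      using that F h_cont
      by (intro orth[of \<alpha> \<beta> "\<lambda>t. F t - F \<alpha>"]) (auto intro!: derivative_eq_intros simp: h_def k_out)
    \<comment> \<open>Subtracting \<open>h t * c\<close> costs nothing, again because
      \<open>h\<close> has integral zero; it completes the square.\<close>
    moreover have "integral {\<alpha>..\<beta>} (\<lambda>t. k t * (g t - c)\<^sup>2) = integral {\<alpha>..\<beta>} (\<lambda>t. h t * g t - h t * c)"
      by (rule integral_cong) (simp add: h_eq power2_eq_square algebra_simps)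
    ultimately have "integral {\<alpha>..\<beta>} (\<lambda>t. k t * (g t - c)\<^sup>2) = 0"
      using int h_int by (simp add: integral_diff)
    then have "\<forall>t\<in>{\<alpha>..\<beta>}. k t * (g t - c)\<^sup>2 = 0"
      using \<open>\<alpha> < \<beta>\<close> k_nonneg
      by (subst (asm) integral_eq_0_iff) (auto intro!: continuous_intros k_cont g_cont)
    then have "g t = c" if "t \<in> {\<alpha><..<\<beta>}" for t
      using k_pos[OF that] that by force
    then show ?thesis by blast
  qed
  have const: "g s = g t" if "s > 0" "t > 0" for s t
  proof -
    have "0 < min s t / 2" "min s t / 2 < max s t + 1" "s \<in> {min s t / 2<..<max s t + 1}"
      "t \<in> {min s t / 2<..<max s t + 1}"
      using that by auto
    then show ?thesis
      using loc by metis
  qed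
  \<comment> \<open>Test functions live at positive times, so the value at 0 is reached only through
    continuity from the right.\<close>
  have "(g \<longlongrightarrow> g 0) (at_right 0)"
    by (rule tendsto_within_subset[of _ _ _ "{0..}"]) (use cont in \<open>auto simp: continuous_on_def\<close>)
  moreover have "\<forall>\<^sub>F s in at_right 0. g s = g 1"
    using eventually_at_right_less[of 0] by (rule eventually_mono) (auto intro: const)
  ultimately have "((\<lambda>_. g 1) \<longlongrightarrow> g 0) (at_right (0::real))"
    by (rule Lim_transform_eventually)
  then have "g 1 = g 0"
    by (simp add: tendsto_const_iff)
  then show ?thesis using const[of t 1] \<open>t \<ge> 0\<close> by (cases "t = 0") auto
qed

text \<open>The outer square smooths the corners of the truncated parabola at -1 and 1, giving the
  continuous differentiability that \<open>test_function\<close> requires.\<close>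

definition bump :: "real \<Rightarrow> real" where
  "bump y = (max 0 (1 - y\<^sup>2))\<^sup>2"

definition bump' :: "real \<Rightarrow> real" where
  "bump' y = - 4 * y * max 0 (1 - y\<^sup>2)"

lemma has_real_derivative_max_0_sq:
  "((\<lambda>u::real. (max 0 u)\<^sup>2) has_real_derivative 2 * max 0 u) (at u)"
proof -
  consider "u < 0" | "u = 0" | "u > 0" by linarith
  then show ?thesis
  proof cases
    case 1
    have "((\<lambda>u::real. 0) has_real_derivative 2 * max 0 u) (at u)" using 1 by simp
    then show ?thesis
      by (rule has_field_derivative_transform_within_open[where S = "{..<0}"]) (use 1 in auto)
  next
    case 2
    \<comment> \<open>At the corner the difference quotient is at most \<open>\<bar>h\<bar>\<close>
      in absolute value.\<close>
    have "((\<lambda>h::real. (max 0 h)\<^sup>2 / h) \<longlongrightarrow> 0) (at 0)"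
    proof (rule Lim_null_comparison)
      show "\<forall>\<^sub>F h in at 0. norm ((max 0 h)\<^sup>2 / h) \<le> \<bar>h::real\<bar>"
        by (intro always_eventually allI) (auto simp: max_def power2_eq_square)
    qed (auto intro!: tendsto_eq_intros)
    then show ?thesis using 2 by (simp add: DERIV_def)
  next
    case 3
    have "((\<lambda>u::real. u\<^sup>2) has_real_derivative 2 * max 0 u) (at u)"
      using 3 by (auto intro!: derivative_eq_intros)
    then show ?thesis
      by (rule has_field_derivative_transform_within_open[where S = "{0<..}"]) (use 3 in auto)
  qed
qed

lemma has_real_derivative_bump: "(bump has_real_derivative bump' y) (at y)"
proof -
  have "((\<lambda>y::real. 1 - y\<^sup>2) has_real_derivative - 2 * y) (at y)"
    by (auto intro!: derivative_eq_intros)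
  from DERIV_chain2[OF has_real_derivative_max_0_sq this]
  show ?thesis by (simp add: bump_def[abs_def] bump'_def mult_ac)
qed

lemma continuous_on_bump: "continuous_on S bump"
  unfolding bump_def[abs_def] by (intro continuous_intros)

lemma continuous_on_bump': "continuous_on S bump'"
  unfolding bump'_def[abs_def] by (intro continuous_intros)

lemma bump_bounds: "0 \<le> bump y" "bump y \<le> 1"
  by (auto simp: bump_def intro!: power_le_one)

lemma bump_eq_1_iff: "bump y = 1 \<longleftrightarrow> y = 0"
  by (auto simp: bump_def max_def power2_eq_1_iff)

lemma bump_eq_0: "\<bar>y\<bar> \<ge> 1 \<Longrightarrow> bump y = 0"
  using abs_square_less_1[of y] by (simp add: bump_def)

lemma bump_lipschitz: "\<bar>bump y - bump z\<bar> \<le> 4 * \<bar>y - z\<bar>"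
proof -
  have "\<bar>bump' y\<bar> \<le> 4" for y
  proof (cases "\<bar>y\<bar> \<le> 1")
    case True
    then have "\<bar>y\<bar> * \<bar>max 0 (1 - y\<^sup>2)\<bar> \<le> 1 * 1" by (intro mult_mono) auto
    then show ?thesis by (simp add: bump'_def abs_mult)
  next
    case False
    then have "1 \<le> y\<^sup>2" using abs_square_le_1[of y] by linarith
    then show ?thesis by (simp add: bump'_def)
  qed
  then show ?thesis
    using field_differentiable_bound[of UNIV bump bump' 4 y z] has_real_derivative_bump by auto
qed

lemma transport_solution_unique:
  assumes sol: "transport_solution (\<lambda>_ _. 1) (return borel 0) \<sigma>" and "t \<ge> 0"
  shows "\<sigma> t = return borel t"
proof -
  have dist: "real_distribution (\<sigma> t)" if "t \<ge> 0" for t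
    using sol that by (auto simp: transport_solution_def)
  have narrow: "continuous_on {0..} (\<lambda>t. LINT x|\<sigma> t. f x)"
    if "continuous_on UNIV f" "bounded (range f)" for f :: "real \<Rightarrow> real"
    using sol that by (auto simp: transport_solution_def)
  have init: "\<sigma> 0 = return borel 0"
    using sol by (auto simp: transport_solution_def)
  have weak: "(LINT t:{0<..}|lborel. (LINT x|\<sigma> t. \<phi>t (t, x) + 1 * \<phi>x (t, x))) = 0"
    if "test_function \<phi> \<phi>t \<phi>x" for \<phi> \<phi>t \<phi>x
    using sol that by (auto simp: transport_solution_def)
  have [measurable]: "bump \<in> borel_measurable borel"
    by (intro borel_measurable_continuous_onI continuous_on_bump)
  have integrable: "integrable (\<sigma> t) (\<lambda>x. bump (x - s))" if "t \<ge> 0" for s t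
  proof -
    interpret real_distribution "\<sigma> t" by (rule dist[OF that])
    show ?thesis by (rule integrable_const_bound[of _ 1]) (auto simp: bump_bounds)
  qed
  define g where "g t = (LINT x|\<sigma> t. bump (x - t))" for t
  have g_cont: "continuous_on {0..} g"
    unfolding continuous_on_def
  proof
    fix s :: real assume s: "s \<in> {0..}"
    \<comment> \<open>In \<open>g\<close> both the measure and the integrand move. With the shift
      frozen at \<open>s\<close>, narrow continuity handles the measure; the Lipschitz bound on
      \<open>bump\<close> controls the remaining error uniformly in \<open>x\<close>.\<close>
    let ?G = "\<lambda>t. LINT x|\<sigma> t. bump (x - s)"
    have "continuous_on {0..} ?G"
      by (rule narrow)
         (auto intro!: continuous_intros continuous_on_compose2[OF continuous_on_bump[of UNIV]]
           boundedI[of _ 1] simp: bump_bounds)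
    then have "(?G \<longlongrightarrow> g s) (at s within {0..})"
      using s by (auto simp: continuous_on_def g_def)
    moreover have "((\<lambda>t. g t - ?G t) \<longlongrightarrow> 0) (at s within {0..})"
    proof (rule Lim_null_comparison)
      have "\<bar>g t - ?G t\<bar> \<le> 4 * \<bar>t - s\<bar>" if "t \<ge> 0" for t
      proof -
        interpret real_distribution "\<sigma> t" by (rule dist[OF that])
        have "\<bar>g t - ?G t\<bar> = \<bar>LINT x|\<sigma> t. bump (x - t) - bump (x - s)\<bar>"
          using integrable[OF that] by (simp add: g_def)
        also have "\<dots> \<le> (LINT x|\<sigma> t. \<bar>bump (x - t) - bump (x - s)\<bar>)"
          by (rule integral_abs_bound)
        also have "\<dots> \<le> (LINT x|\<sigma> t. 4 * \<bar>t - s\<bar>)"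
        proof (rule integral_mono)
          show "\<bar>bump (x - t) - bump (x - s)\<bar> \<le> 4 * \<bar>t - s\<bar>" for x
            using bump_lipschitz[of "x - t" "x - s"] by (simp add: abs_minus_commute)
        qed (use integrable[OF that] in auto)
        also have "\<dots> = 4 * \<bar>t - s\<bar>" using prob_space by simp
        finally show ?thesis .
      qed
      then show "\<forall>\<^sub>F t in at s within {0..}. norm (g t - ?G t) \<le> 4 * \<bar>t - s\<bar>"
        by (auto simp: eventually_at_filter)
    qed (auto intro!: tendsto_eq_intros)
    ultimately have "((\<lambda>t. ?G t + (g t - ?G t)) \<longlongrightarrow> g s + 0) (at s within {0..})"
      by (rule tendsto_add)
    then show "(g \<longlongrightarrow> g s) (at s within {0..})" by simp
  qed
  have "g t = g 0"
  proof (rule weak_derivative_zero_imp_constant[OF g_cont _ \<open>t \<ge> 0\<close>])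
    fix \<eta> \<eta>' :: "real \<Rightarrow> real" and \<alpha> \<beta> :: real
    assume "0 < \<alpha>" "\<alpha> < \<beta>" and der: "\<And>t. (\<eta> has_real_derivative \<eta>' t) (at t)"
      and cont: "continuous_on UNIV \<eta>'" and out: "\<And>t. t \<notin> {\<alpha>..\<beta>} \<Longrightarrow> \<eta> t = 0 \<and> \<eta>' t = 0"
    \<comment> \<open>The factor \<open>bump (x - t)\<close> is constant along characteristics, so
      in \<open>?\<phi>t + ?\<phi>x\<close> the \<open>bump'\<close> terms cancel and only
      \<open>\<eta>' t * bump (x - t)\<close> remains.\<close>
    let ?\<phi> = "\<lambda>p. \<eta> (fst p) * bump (snd p - fst p)"
    let ?\<phi>t = "\<lambda>p. \<eta>' (fst p) * bump (snd p - fst p) - \<eta> (fst p) * bump' (snd p - fst p)"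
    let ?\<phi>x = "\<lambda>p. \<eta> (fst p) * bump' (snd p - fst p)"
    have "test_function ?\<phi> ?\<phi>t ?\<phi>x"
      unfolding test_function_def
    proof (intro conjI allI)
      fix p :: "real \<times> real"
      have "((\<lambda>p. \<eta> (fst p)) has_derivative (\<lambda>h. fst h * \<eta>' (fst p))) (at p)"
        by (intro DERIV_compose_FDERIV[OF der] derivative_intros)
      moreover have "((\<lambda>p. bump (snd p - fst p)) has_derivative
          (\<lambda>h. (snd h - fst h) * bump' (snd p - fst p))) (at p)"
        by (intro DERIV_compose_FDERIV[OF has_real_derivative_bump] derivative_intros)
      ultimately show "(?\<phi> has_derivative (\<lambda>h. ?\<phi>t p * fst h + ?\<phi>x p * snd h)) (at p)"
        by (rule has_derivative_eq_rhs[OF has_derivative_mult]) (simp add: fun_eq_iff algebra_simps)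
    next
      have "continuous_on UNIV \<eta>"
        using der DERIV_isCont by (auto simp: continuous_on_eq_continuous_at)
      note cs = continuous_on_compose2[OF this] continuous_on_compose2[OF cont]
        continuous_on_compose2[OF continuous_on_bump[of UNIV]]
        continuous_on_compose2[OF continuous_on_bump'[of UNIV]]
      show "continuous_on UNIV ?\<phi>t" "continuous_on UNIV ?\<phi>x"
        by (intro continuous_intros cs; simp)+
      \<comment> \<open>The spatial range is the time range enlarged by 1, the radius of the support
        of \<open>bump\<close>.\<close>
      have "?\<phi> p = 0" if "p \<notin> {\<alpha>..\<beta>} \<times> {\<alpha> - 1..\<beta> + 1}" for p
      proof (cases "fst p \<in> {\<alpha>..\<beta>}")
        case True
        then have "\<bar>snd p - fst p\<bar> \<ge> 1" using that by (cases p) auto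
        then show ?thesis by (simp add: bump_eq_0)
      qed (simp add: out)
      then show "\<exists>K. compact K \<and> K \<subseteq> {0<..} \<times> UNIV \<and> (\<forall>p. p \<notin> K \<longrightarrow> ?\<phi> p = 0)"
        using \<open>0 < \<alpha>\<close>
        by (intro exI[of _ "{\<alpha>..\<beta>} \<times> {\<alpha> - 1..\<beta> + 1}"]) (auto intro!: compact_Times)
    qed
    from weak[OF this] have "(LINT t:{0<..}|lborel. \<eta>' t * g t) = 0"
      by (simp add: g_def)
    also have "(LINT t:{0<..}|lborel. \<eta>' t * g t) = (LINT t:{\<alpha>..\<beta>}|lborel. \<eta>' t * g t)"
      unfolding set_lebesgue_integral_def
    proof (rule Bochner_Integration.integral_cong)
      show "indicator {0<..} t *\<^sub>R (\<eta>' t * g t) = indicator {\<alpha>..\<beta>} t *\<^sub>R (\<eta>' t * g t)" for t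
        using out[of t] \<open>0 < \<alpha>\<close> by (cases "t \<in> {\<alpha>..\<beta>}") auto
    qed simp
    also have "\<dots> = integral {\<alpha>..\<beta>} (\<lambda>t. \<eta>' t * g t)"
      using \<open>0 < \<alpha>\<close>
      by (intro set_borel_integral_eq_integral(2) borel_integrable_atLeastAtMost' continuous_intros
          continuous_on_subset[OF cont] continuous_on_subset[OF g_cont]) auto
    finally show "integral {\<alpha>..\<beta>} (\<lambda>t. \<eta>' t * g t) = 0" .
  qed
  also have "g 0 = 1"
    unfolding g_def init by (subst integral_return) (auto simp: bump_eq_1_iff)
  finally have "g t = 1" .
  interpret real_distribution "\<sigma> t" by (rule dist[OF \<open>t \<ge> 0\<close>])
  \<comment> \<open>A nonnegative function with integral zero vanishes almost everywhere, and
    \<open>1 - bump (x - t)\<close> vanishes only at \<open>x = t\<close>.\<close>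
  have "(LINT x|\<sigma> t. 1 - bump (x - t)) = 0"
    using integrable[OF \<open>t \<ge> 0\<close>] \<open>g t = 1\<close> prob_space by (simp add: g_def)
  then have "AE x in \<sigma> t. 1 - bump (x - t) = 0"
    using integrable[OF \<open>t \<ge> 0\<close>]
    by (subst (asm) integral_nonneg_eq_0_iff_AE) (auto simp: bump_bounds)
  then have "AE x in \<sigma> t. x = t"
    by (rule AE_mp) (auto simp: bump_eq_1_iff)
  then have "\<sigma> t = return (\<sigma> t) t"
    by (rule AE_eq_constD)
  also have "\<dots> = return borel t"
    by (rule return_cong) simp
  finally show ?thesis .
qed

section \<open>Mean absolute deviation of the symmetric binomial law\<close>

text \<open>Pascal's rule in summed form: up to normalisation, conditioning on one of the
  \<open>Suc n\<close> coin tosses.\<close>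

lemma sum_binomial_Suc:
  fixes f :: "nat \<Rightarrow> real"
  shows "(\<Sum>j\<le>Suc n. real (Suc n choose j) * f j) = (\<Sum>j\<le>n. real (n choose j) * (f j + f (Suc j)))"
proof -
  have "f 0 + (\<Sum>j\<le>n. real (n choose Suc j) * f (Suc j)) = (\<Sum>j\<le>Suc n. real (n choose j) * f j)"
    by (subst sum.atMost_Suc_shift) simp
  then show ?thesis
    by (subst sum.atMost_Suc_shift) (simp add: algebra_simps sum.distrib)
qed

text \<open>The probability of exactly \<open>m\<close> heads in \<open>2 * m\<close> fair
  tosses.\<close>

definition central_prob :: "nat \<Rightarrow> real" where
  "central_prob m = real (2 * m choose m) / 4 ^ m"

lemma central_prob_pos: "central_prob m > 0"
  by (simp add: central_prob_def)

lemma central_prob_Suc: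
  "central_prob (Suc m) = central_prob m * (2 * real m + 1) / (2 * real m + 2)"
proof -
  have "real (2 * k choose k) = fact (2 * k) / (fact k)\<^sup>2" for k
    by (simp add: binomial_fact power2_eq_square mult_2)
  then have *: "central_prob k = fact (2 * k) / ((fact k)\<^sup>2 * 4 ^ k)" for k
    by (simp add: central_prob_def)
  show ?thesis
    unfolding * by (simp add: power2_eq_square divide_simps) (simp add: algebra_simps)
qed

text \<open>Induction by one more toss. With \<open>y = j - n / 2\<close>, a multiple of 1/2, the
  sum of \<bar>y - 1/2\<bar> and \<bar>y + 1/2\<bar> is 2\<bar>y\<bar> unless \<open>y = 0\<close>,
  where it is 1. So only the central outcome contributes beyond doubling.\<close>

lemma sum_binomial_abs_deviation:
  "(\<Sum>j\<le>n. real (n choose j) * \<bar>real j - real n / 2\<bar>) = real n / 2 * 2 ^ n * central_prob (n div 2)"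
proof (induction n)
  case (Suc n)
  let ?d = "\<lambda>j. \<bar>real j - real n / 2\<bar>"
  have step: "\<bar>real j - real (Suc n) / 2\<bar> + \<bar>real (Suc j) - real (Suc n) / 2\<bar>
      = 2 * ?d j + (if 2 * j = n then 1 else 0)" for j
  proof -
    consider "2 * j = n" | "2 * j + 1 \<le> n" | "n + 1 \<le> 2 * j" by linarith
    then show ?thesis
    proof cases
      case 1
      then have "real n = 2 * real j" by linarith
      with 1 show ?thesis by simp
    next
      case 2
      then have "2 * real j + 1 \<le> real n" by linarith
      with 2 show ?thesis by auto
    next
      case 3
      then have "real n + 1 \<le> 2 * real j" by linarith
      with 3 show ?thesis by auto
    qed
  qed
  have "(\<Sum>j\<le>Suc n. real (Suc n choose j) * \<bar>real j - real (Suc n) / 2\<bar>)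
      = (\<Sum>j\<le>n. real (n choose j) * (2 * ?d j + (if 2 * j = n then 1 else 0)))"
    by (simp only: sum_binomial_Suc step)
  also have "\<dots> = 2 * (\<Sum>j\<le>n. real (n choose j) * ?d j)
      + (\<Sum>j\<le>n. if 2 * j = n then real (n choose j) else 0)"
    unfolding sum_distrib_left sum.distrib[symmetric] by (intro sum.cong) auto
  also have "\<dots> = real (Suc n) / 2 * 2 ^ Suc n * central_prob (Suc n div 2)"
  \<comment> \<open>For even \<open>n\<close> the central term raises the factor from
    \<open>n\<close> to \<open>n + 1\<close>, while the index of \<open>central_prob\<close> stays
    put. For odd \<open>n\<close> there is no central term, but the index rises by one and
    \<open>central_prob_Suc\<close> supplies the balance.\<close>
  proof (cases "even n")
    case True
    then obtain m where m: "n = 2 * m" by blast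
    have "(\<Sum>j\<le>n. if 2 * j = n then real (n choose j) else 0)
        = (\<Sum>j\<le>n. if j = m then real (n choose j) else 0)"
      by (intro sum.cong) (auto simp: m)
    also have "\<dots> = 4 ^ m * central_prob m"
      by (simp add: m central_prob_def)
    finally have "(\<Sum>j\<le>n. if 2 * j = n then real (n choose j) else 0) = 4 ^ m * central_prob m" .
    moreover have "(2::real) ^ n = 4 ^ m" by (simp add: m power_mult)
    ultimately show ?thesis
      unfolding Suc.IH power_Suc by (simp add: m algebra_simps)
  next
    case False
    then obtain m where m: "n = 2 * m + 1" by (elim oddE)
    have "(\<Sum>j\<le>n. if 2 * j = n then real (n choose j) else 0) = 0"
      using False by (intro sum.neutral) auto
    then show ?thesis
      unfolding Suc.IH by (simp add: m power_mult central_prob_Suc field_simps)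
  qed
  finally show ?case .
qed simp

section \<open>Growth of the central probability from Wallis' product\<close>

text \<open>Each term is exactly the reciprocal of a partial Wallis product, by induction with
  \<open>central_prob_Suc\<close>.\<close>

lemma central_prob_sq_tendsto: "(\<lambda>m. (2 * real m + 1) * (central_prob m)\<^sup>2) \<longlonglongrightarrow> 2 / pi"
proof -
  let ?P = "\<lambda>n. \<Prod>k=1..n. (4 * real k ^ 2) / (4 * real k ^ 2 - 1)"
  have "(2 * real m + 1) * (central_prob m)\<^sup>2 = inverse (?P m)" for m
  proof (induction m)
    case (Suc m)
    have *: "?P (Suc m) = ?P m * (4 * real (Suc m) ^ 2 / (4 * real (Suc m) ^ 2 - 1))"
      by (simp add: prod.nat_ivl_Suc' mult.commute)
    have "inverse (?P (Suc m)) = (2 * real m + 1) * (central_prob m)\<^sup>2 *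
        ((2 * real m + 1) * (2 * real m + 3) / (2 * real m + 2)\<^sup>2)"
      unfolding * inverse_mult_distrib Suc.IH[symmetric]
      by (simp add: power2_eq_square algebra_simps)
    also have "\<dots> = (2 * real (Suc m) + 1) * (central_prob (Suc m))\<^sup>2"
      by (simp add: central_prob_Suc power_divide power_mult_distrib)
         (simp add: power2_eq_square algebra_simps)
    finally show ?case by simp
  qed (simp add: central_prob_def)
  moreover have "(\<lambda>m. inverse (?P m)) \<longlonglongrightarrow> inverse (pi / 2)"
    by (intro tendsto_inverse wallis) simp
  ultimately show ?thesis by simp
qed

lemma central_prob_half_sq_tendsto: "(\<lambda>n. real n * (central_prob (n div 2))\<^sup>2) \<longlonglongrightarrow> 2 / pi"
proof -
  have half: "filterlim (\<lambda>n::nat. n div 2) at_top at_top"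
    unfolding filterlim_at_top
  proof
    show "\<forall>\<^sub>F n in sequentially. k \<le> n div 2" for k
      by (rule eventually_sequentiallyI[of "2 * k"]) simp
  qed
  \<comment> \<open>The denominator is \<open>n + 1\<close> or \<open>n\<close> according to the
    parity of \<open>n\<close>, which gives both bounds of the sandwich.\<close>
  have "(\<lambda>n. real n / (2 * real (n div 2) + 1)) \<longlonglongrightarrow> 1"
  proof (rule tendsto_sandwich)
    show "\<forall>\<^sub>F n in sequentially. real n / (real n + 1) \<le> real n / (2 * real (n div 2) + 1)"
    proof (intro always_eventually allI divide_left_mono mult_pos_pos)
      show "2 * real (n div 2) + 1 \<le> real n + 1" for n by linarith
    qed auto
    show "\<forall>\<^sub>F n in sequentially. real n / (2 * real (n div 2) + 1) \<le> 1"
    proof (intro always_eventually allI)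
      have "real n \<le> 2 * real (n div 2) + 1" for n by linarith
      then show "real n / (2 * real (n div 2) + 1) \<le> 1" for n
        by (subst divide_le_eq_1_pos) auto
    qed
    show "(\<lambda>n. real n / (real n + 1)) \<longlonglongrightarrow> 1" by real_asymp
  qed simp
  from tendsto_mult[OF this filterlim_compose[OF central_prob_sq_tendsto half]]
  show ?thesis by (simp add: mult.assoc add_nonneg_eq_0_iff)
qed

section \<open>Wasserstein distance between the Dirac mass and the upwind solution\<close>

lemma nn_integral_grid_measure:
  assumes "finite J" and "\<And>j. j \<notin> J \<Longrightarrow> r j = 0" and [measurable]: "f \<in> borel_measurable borel"
  shows "(\<integral>\<^sup>+x. f x \<partial>grid_measure dx r) = (\<Sum>j\<in>J. ennreal (r j) * f (real_of_int j * dx))"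
  unfolding grid_measure_def point_measure_def
  using assms(1,2)
  by (subst nn_integral_distr)
     (auto simp: nn_integral_density intro!: nn_integral_count_space')

text \<open>Under any coupling the first coordinate is almost surely \<open>t\<close>, so the cost
  depends on the second marginal alone and the infimum runs over a single value.\<close>

lemma wasserstein1_return:
  assumes "prob_space \<nu>" and [measurable_cong]: "sets \<nu> = sets borel"
  shows "wasserstein1 (return borel t) \<nu> = enn2real (\<integral>\<^sup>+x. ennreal \<bar>t - x\<bar> \<partial>\<nu>)"
proof -
  interpret prob_space \<nu> by fact
  have cost: "(\<integral>\<^sup>+p. ennreal \<bar>fst p - snd p\<bar> \<partial>\<gamma>) = (\<integral>\<^sup>+x. ennreal \<bar>t - x\<bar> \<partial>\<nu>)"
    if "\<gamma> \<in> couplings (return borel t) \<nu>" for \<gamma>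
  proof -
    have [measurable_cong]: "sets \<gamma> = sets (borel \<Otimes>\<^sub>M borel)"
      and fst: "distr \<gamma> borel fst = return borel t" and snd: "distr \<gamma> borel snd = \<nu>"
      using that by (auto simp: couplings_def)
    have "AE x in distr \<gamma> borel fst. x = t"
      unfolding fst by (subst AE_return) auto
    then have "AE p in \<gamma>. fst p = t"
      by (rule AE_distrD[rotated]) simp
    then have "(\<integral>\<^sup>+p. ennreal \<bar>fst p - snd p\<bar> \<partial>\<gamma>) = (\<integral>\<^sup>+p. ennreal \<bar>t - snd p\<bar> \<partial>\<gamma>)"
      by (intro nn_integral_cong_AE) auto
    also have "\<dots> = (\<integral>\<^sup>+x. ennreal \<bar>t - x\<bar> \<partial>distr \<gamma> borel snd)"
      by (subst nn_integral_distr) auto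
    finally show ?thesis by (simp add: snd)
  qed
  \<comment> \<open>A coupling must be exhibited: an infimum over the empty set would be infinite,
    and \<open>enn2real\<close> would turn it into 0.\<close>
  have graph: "distr \<nu> (borel \<Otimes>\<^sub>M borel) (Pair t) \<in> couplings (return borel t) \<nu>"
  proof -
    have "distr \<nu> borel (\<lambda>x. t) = return borel t"
      by (rule distr_const) simp
    moreover have "distr \<nu> borel (\<lambda>x. x) = \<nu>"
      by (rule distr_id2) (simp add: assms)
    ultimately show ?thesis
      by (simp add: couplings_def distr_distr comp_def)
  qed
  have "(\<lambda>\<gamma>. \<integral>\<^sup>+p. ennreal \<bar>fst p - snd p\<bar> \<partial>\<gamma>) ` couplings (return borel t) \<nu>
      = (\<lambda>_. \<integral>\<^sup>+x. ennreal \<bar>t - x\<bar> \<partial>\<nu>) ` couplings (return borel t) \<nu>"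
    by (rule image_cong[OF refl cost])
  also have "\<dots> = {\<integral>\<^sup>+x. ennreal \<bar>t - x\<bar> \<partial>\<nu>}"
    using graph by (rule image_constant)
  finally show ?thesis by (simp add: wasserstein1_def)
qed

text \<open>One step averages the values at \<open>j\<close> and \<open>j - 1\<close>, which is
  Pascal's rule after division by a power of 2.\<close>

lemma upwind_eq_binomial:
  fixes r :: "nat \<Rightarrow> int \<Rightarrow> real"
  assumes "\<And>j. r 0 j = (if j = 0 then 1 else 0)"
    and "\<And>n j. r (Suc n) j = r n j - 1 / 2 * (r n j - r n (j - 1))"
  shows "r n j = (if 0 \<le> j then real (n choose nat j) / 2 ^ n else 0)"
proof (induction n arbitrary: j)
  case 0
  then show ?case using assms(1) by (cases "nat j") auto
next
  case (Suc n)
  \<comment> \<open>At \<open>j = 0\<close> truncation makes \<open>nat (j - 1)\<close> equal to 0,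
    where Pascal's rule in this form would fail; that cell has a left neighbour of weight zero and
    is treated apart.\<close>
  have "(n choose nat j) + (n choose nat (j - 1)) = Suc n choose nat j" if "j > 0"
  proof -
    have "nat j = Suc (nat (j - 1))" using that by simp
    then show ?thesis by simp
  qed
  then have *: "real (n choose nat j) + real (n choose nat (j - 1)) = real (Suc n choose nat j)" if "j > 0"
    using that by (metis of_nat_add)
  show ?case
    unfolding assms(2) Suc.IH using * by (cases "j = 0") (auto simp: field_simps)
qed

lemma wasserstein1_upwind:
  fixes r :: "nat \<Rightarrow> int \<Rightarrow> real"
  assumes "dx > 0"
    and "\<And>j. r 0 j = (if j = 0 then 1 else 0)"
    and "\<And>n j. r (Suc n) j = r n j - 1 / 2 * (r n j - r n (j - 1))"
  shows "wasserstein1 (return borel (real n * (dx / 2))) (grid_measure dx (r n))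
    = dx * (real n / 2 * central_prob (n div 2))"
proof -
  note r = upwind_eq_binomial[of r, OF assms(2,3)]
  \<comment> \<open>Used twice: with the constant 1 for the total mass, and with the distance to
    \<open>real n * (dx / 2)\<close>, the mean of the grid law, for the cost.\<close>
  have nn: "(\<integral>\<^sup>+x. ennreal (f x) \<partial>grid_measure dx (r n))
      = ennreal ((\<Sum>j\<le>n. real (n choose j) * f (real j * dx)) / 2 ^ n)"
    if [measurable]: "f \<in> borel_measurable borel" and pos: "\<And>x. f x \<ge> 0" for f
  proof -
    have "(\<integral>\<^sup>+x. ennreal (f x) \<partial>grid_measure dx (r n))
        = (\<Sum>j\<in>int ` {..n}. ennreal (r n j) * ennreal (f (real_of_int j * dx)))"
    proof (rule nn_integral_grid_measure)
      show "r n j = 0" if "j \<notin> int ` {..n}" for j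
      proof (cases "0 \<le> j")
        case True
        then have "n < nat j" using that by (metis atMost_iff image_eqI int_nat_eq not_le)
        then show ?thesis by (simp add: r)
      qed (simp add: r)
    qed auto
    also have "\<dots> = (\<Sum>j\<le>n. ennreal (real (n choose j) / 2 ^ n * f (real j * dx)))"
      by (subst sum.reindex) (auto simp: r ennreal_mult[symmetric] pos inj_on_def intro!: sum.cong)
    also have "\<dots> = ennreal (\<Sum>j\<le>n. real (n choose j) / 2 ^ n * f (real j * dx))"
      by (rule sum_ennreal) (simp add: pos)
    finally show ?thesis by (simp add: sum_divide_distrib)
  qed
  have sets: "sets (grid_measure dx (r n)) = sets borel"
    by (simp add: grid_measure_def)
  have "prob_space (grid_measure dx (r n))"
  proof
    have "emeasure (grid_measure dx (r n)) (space (grid_measure dx (r n)))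
        = (\<integral>\<^sup>+x. ennreal 1 \<partial>grid_measure dx (r n))"
      by simp
    also have "\<dots> = ennreal (real (\<Sum>j\<le>n. n choose j) / 2 ^ n)"
      by (subst nn) auto
    also have "\<dots> = 1" by (simp only: choose_row_sum) simp
    finally show "emeasure (grid_measure dx (r n)) (space (grid_measure dx (r n))) = 1" .
  qed
  then have "wasserstein1 (return borel (real n * (dx / 2))) (grid_measure dx (r n))
      = enn2real (\<integral>\<^sup>+x. ennreal \<bar>real n * (dx / 2) - x\<bar> \<partial>grid_measure dx (r n))"
    by (rule wasserstein1_return) (rule sets)
  also have "\<dots> = (\<Sum>j\<le>n. real (n choose j) * \<bar>real n * (dx / 2) - real j * dx\<bar>) / 2 ^ n"
    by (subst nn) (auto intro!: enn2real_ennreal sum_nonneg divide_nonneg_nonneg simp del: times_divide_eq_right)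
  also have "(\<Sum>j\<le>n. real (n choose j) * \<bar>real n * (dx / 2) - real j * dx\<bar>)
      = dx * (\<Sum>j\<le>n. real (n choose j) * \<bar>real j - real n / 2\<bar>)"
  proof -
    have "\<bar>real n * (dx / 2) - real j * dx\<bar> = \<bar>dx * (real j - real n / 2)\<bar>" for j
      by (subst abs_minus_commute) (simp add: algebra_simps)
    also have "\<dots> j = dx * \<bar>real j - real n / 2\<bar>" for j
      using assms(1) by (simp add: abs_mult)
    finally show ?thesis by (simp add: sum_distrib_left algebra_simps)
  qed
  finally show ?thesis by (simp add: sum_binomial_abs_deviation)
qed

lemma wasserstein1_upwind_asymp:
  fixes r :: "nat \<Rightarrow> int \<Rightarrow> real"
  assumes "dx > 0"
    and "\<And>j. r 0 j = (if j = 0 then 1 else 0)"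
    and "\<And>n j. r (Suc n) j = r n j - 1 / 2 * (r n j - r n (j - 1))"
  shows "(\<lambda>n. wasserstein1 (return borel (real n * (dx / 2))) (grid_measure dx (r n)))
    \<sim>[at_top] (\<lambda>n. 1 / sqrt pi * sqrt (real n * (dx / 2) * dx))"
proof (rule asymp_equivI')
  let ?c = "\<lambda>n. central_prob (n div 2)"
  have "dx * (real n / 2 * ?c n) / (1 / sqrt pi * sqrt (real n * (dx / 2) * dx))
      = sqrt (pi / 2 * (real n * (?c n)\<^sup>2))" if "n > 0" for n
  proof -
    \<comment> \<open>The positive numerator is written as a root, so that the whole quotient
      becomes one root and only the limit of \<open>real n * (?c n)\<^sup>2\<close> matters.\<close>
    have "dx * (real n / 2 * ?c n) = sqrt ((dx * (real n / 2 * ?c n))\<^sup>2)"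
      using assms(1) central_prob_pos[of "n div 2"] by simp
    then have "dx * (real n / 2 * ?c n) / (1 / sqrt pi * sqrt (real n * (dx / 2) * dx))
        = sqrt ((dx * (real n / 2 * ?c n))\<^sup>2 / (1 / pi * (real n * (dx / 2) * dx)))"
      by (simp only: real_sqrt_divide real_sqrt_mult real_sqrt_one)
    also have "(dx * (real n / 2 * ?c n))\<^sup>2 / (1 / pi * (real n * (dx / 2) * dx))
        = pi / 2 * (real n * (?c n)\<^sup>2)"
      using that assms(1) by (simp add: field_simps power2_eq_square)
    finally show ?thesis .
  qed
  then have "\<forall>\<^sub>F n in sequentially. sqrt (pi / 2 * (real n * (?c n)\<^sup>2))
      = wasserstein1 (return borel (real n * (dx / 2))) (grid_measure dx (r n)) /
        (1 / sqrt pi * sqrt (real n * (dx / 2) * dx))"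
    unfolding wasserstein1_upwind[of dx r, OF assms]
    by (intro eventually_mono[OF eventually_gt_at_top[of 0]]) simp
  moreover have "(\<lambda>n. sqrt (pi / 2 * (real n * (?c n)\<^sup>2))) \<longlonglongrightarrow> sqrt (pi / 2 * (2 / pi))"
    by (intro tendsto_intros central_prob_half_sq_tendsto)
  ultimately show "(\<lambda>n. wasserstein1 (return borel (real n * (dx / 2))) (grid_measure dx (r n)) /
        (1 / sqrt pi * sqrt (real n * (dx / 2) * dx))) \<longlonglongrightarrow> 1"
    by (simp add: tendsto_cong)
qed

theorem mainTheorem4:
  fixes a :: "real \<Rightarrow> real \<Rightarrow> real" and \<rho>ini :: "real measure" and \<rho> :: "real \<Rightarrow> real measure"
    and dt dx :: real and r :: "nat \<Rightarrow> int \<Rightarrow> real"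
  assumes "\<And>t x. a t x = 1"
    and "\<rho>ini = return borel 0"
    and "\<And>t. t \<ge> 0 \<Longrightarrow> \<rho> t = return borel t"
    and "dt > 0" and "dx > 0" and "dt / dx = 1 / 2"
    and "\<And>j. r 0 j = (if j = 0 then 1 else 0)"
    and "\<And>n j. r (Suc n) j = r n j - 1 / 2 * (r n j - r n (j - 1))"
  shows "(\<forall>\<sigma>. transport_solution a \<rho>ini \<sigma> \<longleftrightarrow> (\<forall>t\<ge>0. \<sigma> t = \<rho> t)) \<and>
    (\<lambda>n. wasserstein1 (\<rho> (real n * dt)) (grid_measure dx (r n)))
      \<sim>[at_top] (\<lambda>n. 1 / sqrt pi * sqrt (real n * dt * dx))"
proof
  have "a = (\<lambda>_ _. 1)"
    using assms(1) by (simp add: fun_eq_iff)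
  then show "\<forall>\<sigma>. transport_solution a \<rho>ini \<sigma> \<longleftrightarrow> (\<forall>t\<ge>0. \<sigma> t = \<rho> t)"
    unfolding assms(2) using transport_solution_moving_dirac transport_solution_unique assms(3) by metis
  \<comment> \<open>The ratio 1/2 places the exact position \<open>real n * dt\<close> at the mean
    of the binomial law on the grid.\<close>
  have dt: "dt = dx / 2"
    using assms(5,6) by (simp add: field_simps)
  have "\<rho> (real n * dt) = return borel (real n * (dx / 2))" for n
    using assms(3)[of "real n * dt"] assms(4) by (simp add: dt)
  then show "(\<lambda>n. wasserstein1 (\<rho> (real n * dt)) (grid_measure dx (r n)))
      \<sim>[at_top] (\<lambda>n. 1 / sqrt pi * sqrt (real n * dt * dx))"
    using wasserstein1_upwind_asymp[of dx r, OF assms(5,7,8)] by (simp only: dt)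
qed

end
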